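(* Let $(G,b,w)$ be an instance of SFP and let $(G',1,w')$ be the instance of SRP reduced from $(G,b,w)$. Then the following three statements hold: (i) $(G,b,w)$ has a stable solution if and only if $(G',1,w')$ has a stable solution; (ii) $(G,b,w)$ has a stable solution $(M,p)$ for some maximum weight $b$-matching $M$ of $G$ if and only if $(G',1,w')$ has a stable solution $(M',p')$, where $M'$ is reduced from $M$ and $p'(i_j)=p(i,j)$ and $p'(j_i)=p(j,i)$ for every $ij\in M$; (iii) a solution $(M,p)$ for $(G,b,w)$, where $M$ is a maximum weight $b$-matching of $G$, is stable if and only if every solution $(M',p')$ for $(G',1,w')$ reduced from $(M,p)$ is stable.
   Context: An instance of SFP (a multiple partners matching game) is a triple $(G,b,w)$ where $G=(N,E)$ is a finite undirected graph without loops or multiple edges, $b:N\to\mathbb{Z}_{\ge 0}$ is a vertex capacity function, and $w:E\to\mathbb{R}_{\ge 0}$ is an edge weighting. A set $M\subseteq E$ is a $b$-matching if every $i\in N$ is incident to at most $b(i)$ edges of $M$; its weight is $w(M)=\sum_{e\in M}w(e)$. If $ij\in M$, then $i$ and $j$ are partners under $M$. A function $p:N\times N\to\mathbb{R}_{\ge 0}$ is a payoff vector compatible with $M$ if $p(i,j)+p(j,i)=w(ij)$ for all $ij\in M$ and $p(i,j)=p(j,i)=0$ for all $ij\notin M$. A pair $(M,p)$ with $M$ a $b$-matching and $p$ a payoff vector compatible with $M$ is a solution. The utility function $u_p:N\to\mathbb{R}_{\ge 0}$ is defined by $u_p(i)=\min\{p(i,j): ij\in M\}$ if $i$ is saturated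 by $M$, i.e. incident with $b(i)$ edges of $M$, and $u_p(i)=0$ otherwise. A solution $(M,p)$ is stable if $u_p(i)+u_p(j)\ge w(ij)$ for all $ij\in E\setminus M$. SRP is the special case $b\equiv 1$. In that case a payoff vector is viewed as a function $p$ on the vertex set: $(M,p)$ is a solution if $M$ is a matching, $p\ge 0$, $p(i)+p(j)=w(ij)$ for all $ij\in M$ and $p(i)=0$ for every vertex $i$ not covered by $M$; it is stable if $p(i)+p(j)\ge w(ij)$ for all $ij\in E\setminus M$. Reduced instance. Given $(G,b,w)$, the SRP instance $(G',1,w')$ reduced from it, with $G'=(N',E')$, is defined as follows. For each $i\in N$, $N'$ contains $b(i)$ copies $i^1,\dots,i^{b(i)}$. For each edge $ij\in E$, $N'$ contains four further vertices $\overline{i_j}, i_j, j_i, \overline{j_i}$, and $E'$ contains the edges $i^s\overline{i_j}$ ($s=1,\dots,b(i)$), $\overline{i_j}i_j$, $i_jj_i$, $j_i\overline{j_i}$ and $\overline{j_i}j^t$ ($t=1,\dots,b(j)$), each with $w'$-weight $w(ij)$. Reduced matchings and solutions. Given a $b$-matching $M$ of $G$, order for each $i\in N$ its partners under $M$. A matching $M'$ of $G'$ is reduced from $M$ if (for some choice of these orderings) it consists of: for each $ij\in M$, where $j$ is the $s$-th partner of $i$ and $i$ is the $t$-th partner of $j$, the edges $i^s\overline{i_j}$, $i_jj_i$, $\overline{j_i}j^t$; and for each $ij\in E\setminus M$, the edges $\overline{i_j}i_j$ and $j_i\overline{j_i}$. Given a solution $(M,p)$ for $(G,b,w)$, a pair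 $(M',p')$ is reduced from $(M,p)$ if $M'$ is reduced from $M$ and $p'$ is the function on $N'$ given by: $p'(i^s)=u_p(i)$ for all $i\in N$ and $s\in\{1,\dots,b(i)\}$; for $ij\in M$: $p'(i_j)=p(i,j)$, $p'(\overline{i_j})=w(ij)-u_p(i)$, $p'(j_i)=p(j,i)$, $p'(\overline{j_i})=w(ij)-u_p(j)$; for $ij\in E\setminus M$: $p'(i_j)=\min\{u_p(i),w(ij)\}$, $p'(\overline{i_j})=w(ij)-\min\{u_p(i),w(ij)\}$, $p'(j_i)=\min\{u_p(j),w(ij)\}$, $p'(\overline{j_i})=w(ij)-\min\{u_p(j),w(ij)\}$. *)

theory Defs
  imports "HOL-Library.Extended_Real"
begin

definition simple_graph :: "'v set \<Rightarrow> 'v set set \<Rightarrow> bool" where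
  "simple_graph V E \<longleftrightarrow> finite V \<and> E \<subseteq> {{i, j} | i j. i \<in> V \<and> j \<in> V \<and> i \<noteq> j}"

definition sfp_instance ::
    "'v set \<Rightarrow> 'v set set \<Rightarrow> ('v \<Rightarrow> nat) \<Rightarrow> ('v set \<Rightarrow> real) \<Rightarrow> bool" where
  "sfp_instance V E b w \<longleftrightarrow> simple_graph V E \<and> (\<forall>e\<in>E. 0 \<le> w e)"

definition b_matching ::
    "'v set \<Rightarrow> 'v set set \<Rightarrow> ('v \<Rightarrow> nat) \<Rightarrow> 'v set set \<Rightarrow> bool" where
  "b_matching V E b M \<longleftrightarrow> M \<subseteq> E \<and> (\<forall>i\<in>V. card {e \<in> M. i \<in> e} \<le> b i)"

definition max_weight_b_matching ::
    "'v set \<Rightarrow> 'v set set \<Rightarrow> ('v \<Rightarrow> nat) \<Rightarrow> ('v set \<Rightarrow> real) \<Rightarrow> 'v set set \<Rightarrow> bool" where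
  "max_weight_b_matching V E b w M \<longleftrightarrow>
     b_matching V E b M \<and> (\<forall>L. b_matching V E b L \<longrightarrow> sum w L \<le> sum w M)"

definition partners :: "'v set set \<Rightarrow> 'v \<Rightarrow> 'v set" where
  "partners M i = {j. {i, j} \<in> M}"

definition saturated :: "('v \<Rightarrow> nat) \<Rightarrow> 'v set set \<Rightarrow> 'v \<Rightarrow> bool" where
  "saturated b M i \<longleftrightarrow> card {e \<in> M. i \<in> e} = b i"

definition compatible_payoff ::
    "'v set \<Rightarrow> ('v set \<Rightarrow> real) \<Rightarrow> 'v set set \<Rightarrow> ('v \<Rightarrow> 'v \<Rightarrow> real) \<Rightarrow> bool" where
  "compatible_payoff V w M p \<longleftrightarrow>
     (\<forall>i\<in>V. \<forall>j\<in>V. 0 \<le> p i j) \<and>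
     (\<forall>i\<in>V. \<forall>j\<in>V. {i, j} \<in> M \<longrightarrow> p i j + p j i = w {i, j}) \<and>
     (\<forall>i\<in>V. \<forall>j\<in>V. {i, j} \<notin> M \<longrightarrow> p i j = 0 \<and> p j i = 0)"

definition sfp_solution ::
    "'v set \<Rightarrow> 'v set set \<Rightarrow> ('v \<Rightarrow> nat) \<Rightarrow> ('v set \<Rightarrow> real)
      \<Rightarrow> 'v set set \<Rightarrow> ('v \<Rightarrow> 'v \<Rightarrow> real) \<Rightarrow> bool" where
  "sfp_solution V E b w M p \<longleftrightarrow> b_matching V E b M \<and> compatible_payoff V w M p"

(* The infimum is the minimum over the finite partner set, except for a vertex of
   capacity 0: it is saturated without partners, and the minimum over the empty set is
   read as infinity, so that such a vertex never takes part in a blocking edge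
   (in the reduced instance it has no copies).  For all other vertices the utility is
   a nonnegative real. *)
definition utility ::
    "('v \<Rightarrow> nat) \<Rightarrow> 'v set set \<Rightarrow> ('v \<Rightarrow> 'v \<Rightarrow> real) \<Rightarrow> 'v \<Rightarrow> ereal" where
  "utility b M p i =
     (if saturated b M i then (INF j\<in>partners M i. ereal (p i j)) else 0)"

definition sfp_stable_solution ::
    "'v set \<Rightarrow> 'v set set \<Rightarrow> ('v \<Rightarrow> nat) \<Rightarrow> ('v set \<Rightarrow> real)
      \<Rightarrow> 'v set set \<Rightarrow> ('v \<Rightarrow> 'v \<Rightarrow> real) \<Rightarrow> bool" where
  "sfp_stable_solution V E b w M p \<longleftrightarrow>
     sfp_solution V E b w M p \<and>
     (\<forall>i j. {i, j} \<in> E - M \<longrightarrow> ereal (w {i, j}) \<le> utility b M p i + utility b M p j)"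

definition srp_solution ::
    "'n set \<Rightarrow> 'n set set \<Rightarrow> ('n set \<Rightarrow> real) \<Rightarrow> 'n set set \<Rightarrow> ('n \<Rightarrow> real) \<Rightarrow> bool" where
  "srp_solution V E w M p \<longleftrightarrow>
     b_matching V E (\<lambda>_. 1) M \<and>
     (\<forall>i\<in>V. 0 \<le> p i) \<and>
     (\<forall>i j. {i, j} \<in> M \<longrightarrow> p i + p j = w {i, j}) \<and>
     (\<forall>i\<in>V. i \<notin> \<Union>M \<longrightarrow> p i = 0)"

definition srp_stable_solution ::
    "'n set \<Rightarrow> 'n set set \<Rightarrow> ('n set \<Rightarrow> real) \<Rightarrow> 'n set set \<Rightarrow> ('n \<Rightarrow> real) \<Rightarrow> bool" where
  "srp_stable_solution V E w M p \<longleftrightarrow>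
     srp_solution V E w M p \<and>
     (\<forall>i j. {i, j} \<in> E - M \<longrightarrow> w {i, j} \<le> p i + p j)"

(* Copy i s is the s-th copy of i; Half i j is the vertex written i_j, and
   BarHalf i j the vertex written i_j with an overline. *)
datatype 'v rvertex = Copy 'v nat | Half 'v 'v | BarHalf 'v 'v

definition red_vertices :: "'v set \<Rightarrow> 'v set set \<Rightarrow> ('v \<Rightarrow> nat) \<Rightarrow> 'v rvertex set" where
  "red_vertices V E b =
     {Copy i s | i s. i \<in> V \<and> s \<in> {1..b i}} \<union>
     {Half i j | i j. {i, j} \<in> E} \<union>
     {BarHalf i j | i j. {i, j} \<in> E}"

(* Both orientations (i, j) and (j, i) of an edge of E contribute, which yields
   all five kinds of edges of the gadget of that edge. *)
definition red_edges :: "'v set set \<Rightarrow> ('v \<Rightarrow> nat) \<Rightarrow> 'v rvertex set set" where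
  "red_edges E b =
     {{Copy i s, BarHalf i j} | i j s. {i, j} \<in> E \<and> s \<in> {1..b i}} \<union>
     {{BarHalf i j, Half i j} | i j. {i, j} \<in> E} \<union>
     {{Half i j, Half j i} | i j. {i, j} \<in> E}"

(* For every edge of the gadget of ij, the union of the supports of its two
   endpoints is {i, j}. *)
primrec support :: "'v rvertex \<Rightarrow> 'v set" where
  "support (Copy i s) = {i}"
| "support (Half i j) = {i, j}"
| "support (BarHalf i j) = {i, j}"

definition red_weight :: "('v set \<Rightarrow> real) \<Rightarrow> 'v rvertex set \<Rightarrow> real" where
  "red_weight w e = w (\<Union>x\<in>e. support x)"

(* pos i j = s means that j is the s-th partner of i. *)
definition partner_orders :: "'v set \<Rightarrow> 'v set set \<Rightarrow> ('v \<Rightarrow> 'v \<Rightarrow> nat) \<Rightarrow> bool" where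
  "partner_orders V M pos \<longleftrightarrow>
     (\<forall>i\<in>V. bij_betw (pos i) (partners M i) {1..card (partners M i)})"

definition reduced_matching ::
    "'v set \<Rightarrow> 'v set set \<Rightarrow> 'v set set \<Rightarrow> 'v rvertex set set \<Rightarrow> bool" where
  "reduced_matching V E M M' \<longleftrightarrow>
     (\<exists>pos. partner_orders V M pos \<and>
        M' = {{Copy i (pos i j), BarHalf i j} | i j. {i, j} \<in> M} \<union>
             {{Half i j, Half j i} | i j. {i, j} \<in> M} \<union>
             {{BarHalf i j, Half i j} | i j. {i, j} \<in> E - M})"

definition reduced_solution ::
    "'v set \<Rightarrow> 'v set set \<Rightarrow> ('v \<Rightarrow> nat) \<Rightarrow> ('v set \<Rightarrow> real)
      \<Rightarrow> 'v set set \<Rightarrow> ('v \<Rightarrow> 'v \<Rightarrow> real)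
      \<Rightarrow> 'v rvertex set set \<Rightarrow> ('v rvertex \<Rightarrow> real) \<Rightarrow> bool" where
  "reduced_solution V E b w M p M' p' \<longleftrightarrow>
     reduced_matching V E M M' \<and>
     (\<forall>i\<in>V. \<forall>s\<in>{1..b i}. ereal (p' (Copy i s)) = utility b M p i) \<and>
     (\<forall>i j. {i, j} \<in> M \<longrightarrow>
        p' (Half i j) = p i j \<and>
        ereal (p' (BarHalf i j)) = ereal (w {i, j}) - utility b M p i) \<and>
     (\<forall>i j. {i, j} \<in> E - M \<longrightarrow>
        ereal (p' (Half i j)) = min (utility b M p i) (ereal (w {i, j})) \<and>
        ereal (p' (BarHalf i j)) =
          ereal (w {i, j}) - min (utility b M p i) (ereal (w {i, j})))"

end

theory Submission
  imports Defs
begin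

text \<open>
  If \<open>(M, p)\<close> is a solution, every pair reduced from it is a solution, and all stability
  inequalities on the gadgets hold automatically except the one on an edge \<open>i_j j_i\<close> with
  \<open>ij\<close> unmatched, which is the stability condition of \<open>(M, p)\<close> for \<open>ij\<close>.

  Conversely, from a stable \<open>(M', p')\<close> one takes for \<open>M\<close> the edges \<open>ij\<close> whose gadget contains
  \<open>i_j j_i\<close> and matches both barred vertices to copies, and \<open>p(i, j) = p'(i_j)\<close>. On the gadget of any
  other edge \<open>p'\<close> is tight on the two outer pairs, and the copies matched into it have payoff 0.
  Hence \<open>p'(i_j) \<le> u_p(i)\<close> for every unmatched \<open>ij\<close>: stability on \<open>i^s\<close> and the barred vertex
  bounds \<open>p'(i_j)\<close> by \<open>p'(i^s)\<close> for all \<open>s\<close>. A copy matched to the barred vertex of an edge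
  \<open>ik\<close> of \<open>M\<close> has payoff at most \<open>p(i, k)\<close>, and if \<open>i\<close> is unsaturated some copy has payoff 0.
  Summing over the edge \<open>i_j j_i\<close> gives stability of \<open>(M, p)\<close>. If \<open>M'\<close> is reduced from some
  b-matching, that b-matching is recovered as \<open>M\<close>. Finally, the b-matching of a stable solution
  has maximum weight by linear programming duality.
\<close>

section \<open>Edges of the gadgets and their weights\<close>

lemma red_weight_simps [simp]:
  "red_weight w {Copy i s, BarHalf i j} = w {i, j}"
  "red_weight w {BarHalf i j, Half i j} = w {i, j}"
  "red_weight w {Half i j, Half j i} = w {i, j}"
proof -
  have "(\<Union>x\<in>{Half i j, Half j i}. support x) = {i, j}" by auto
  then show "red_weight w {Half i j, Half j i} = w {i, j}" unfolding red_weight_def by (simp only:)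
qed (simp_all add: red_weight_def insert_commute)

lemma red_edges_memI:
  assumes "{i, j} \<in> E"
  shows "s \<in> {1..b i} \<Longrightarrow> {Copy i s, BarHalf i j} \<in> red_edges E b"
    and "{BarHalf i j, Half i j} \<in> red_edges E b"
    and "{Half i j, Half j i} \<in> red_edges E b"
  using assms unfolding red_edges_def by blast+

lemma red_edges_memE:
  assumes "e \<in> red_edges E b"
  obtains (copy) i j s where "{i, j} \<in> E" "s \<in> {1..b i}" "e = {Copy i s, BarHalf i j}"
  | (bar) i j where "{i, j} \<in> E" "e = {BarHalf i j, Half i j}"
  | (half) i j where "{i, j} \<in> E" "e = {Half i j, Half j i}"
  using assms unfolding red_edges_def by blast

lemma Copy_BarHalf_mem_red_edgesD:
  assumes "{Copy i s, BarHalf i j} \<in> red_edges E b"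
  shows "{i, j} \<in> E" "s \<in> {1..b i}"
  using assms unfolding red_edges_def by (auto simp: doubleton_eq_iff)

lemma red_edge_at_Half:
  assumes "e \<in> red_edges E b" "Half i j \<in> e"
  shows "e = {Half i j, Half j i} \<or> e = {BarHalf i j, Half i j}"
  using assms by (auto elim!: red_edges_memE)

lemma red_edge_at_BarHalf:
  assumes "e \<in> red_edges E b" "BarHalf i j \<in> e"
  shows "(\<exists>s\<in>{1..b i}. e = {Copy i s, BarHalf i j}) \<or> e = {BarHalf i j, Half i j}"
  using assms by (auto elim!: red_edges_memE)

lemma red_edge_at_Copy:
  assumes "e \<in> red_edges E b" "Copy i s \<in> e"
  shows "\<exists>j. {i, j} \<in> E \<and> e = {Copy i s, BarHalf i j}"
  using assms by (auto elim!: red_edges_memE)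

subsection \<open>Utilities and stable b-matchings\<close>

locale sfp =
  fixes V :: "'v set" and E :: "'v set set" and b :: "'v \<Rightarrow> nat" and w :: "'v set \<Rightarrow> real"
  assumes inst: "sfp_instance V E b w"
begin

abbreviation "V' \<equiv> red_vertices V E b"
abbreviation "E' \<equiv> red_edges E b"
abbreviation "w' \<equiv> red_weight w"

lemma finite_V: "finite V"
  using inst unfolding sfp_instance_def simple_graph_def by blast

lemma edge_vertices:
  assumes "{i, j} \<in> E"
  shows "i \<in> V" "j \<in> V" "i \<noteq> j"
  using assms inst unfolding sfp_instance_def simple_graph_def
  by (force simp: doubleton_eq_iff)+

lemma edgeE:
  assumes "e \<in> E"
  obtains i j where "e = {i, j}" "i \<in> V" "j \<in> V" "i \<noteq> j"
  using assms inst unfolding sfp_instance_def simple_graph_def by blast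

lemma weight_nonneg: "e \<in> E \<Longrightarrow> 0 \<le> w e"
  using inst unfolding sfp_instance_def by blast

lemma finite_E: "finite E"
proof (rule finite_subset)
  show "E \<subseteq> Pow V" by (auto elim: edgeE)
  show "finite (Pow V)" using finite_V by simp
qed

lemma finite_red_vertices: "finite V'"
proof (rule finite_subset)
  let ?S = "(\<lambda>(i, s). Copy i s) ` (SIGMA i:V. {1..b i}) \<union> case_prod Half ` (V \<times> V)
    \<union> case_prod BarHalf ` (V \<times> V)"
  show "V' \<subseteq> ?S"
    unfolding red_vertices_def by (auto dest: edge_vertices)
  show "finite ?S"
    using finite_V by (intro finite_UnI finite_imageI finite_SigmaI) auto
qed

lemma red_vertices_memI:
  "i \<in> V \<Longrightarrow> s \<in> {1..b i} \<Longrightarrow> Copy i s \<in> V'"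
  "{i, j} \<in> E \<Longrightarrow> Half i j \<in> V'"
  "{i, j} \<in> E \<Longrightarrow> BarHalf i j \<in> V'"
  unfolding red_vertices_def by auto

lemma finite_red_edges: "finite E'"
proof (rule finite_subset)
  show "E' \<subseteq> Pow V'"
    by (auto elim!: red_edges_memE intro: red_vertices_memI edge_vertices simp: insert_commute)
  show "finite (Pow V')" using finite_red_vertices by simp
qed

lemma red_matching_unique:
  assumes "b_matching V' E' (\<lambda>_. 1) M'" "e \<in> M'" "f \<in> M'" "v \<in> e" "v \<in> f" "v \<in> V'"
  shows "e = f"
proof -
  \<comment> \<open>Finiteness matters: \<open>card\<close> of an infinite set is 0, so the capacity
    bound alone would not give uniqueness.\<close>
  have "finite M'" using assms(1) finite_red_edges finite_subset
    unfolding b_matching_def by blast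
  then have "finite {e \<in> M'. v \<in> e}" by simp
  moreover have "card {e \<in> M'. v \<in> e} \<le> Suc 0"
    using assms(1,6) unfolding b_matching_def by auto
  ultimately have "\<forall>x\<in>{e \<in> M'. v \<in> e}. \<forall>y\<in>{e \<in> M'. v \<in> e}. x = y"
    using card_le_Suc0_iff_eq by blast
  then show ?thesis using assms(2-5) by blast
qed

text \<open>Capacities count incident edges, whereas utilities and partner orders range over
  partners; this bijection translates between the two.\<close>

lemma bij_betw_partners:
  assumes "M \<subseteq> E"
  shows "bij_betw (\<lambda>j. {i, j}) (partners M i) {e \<in> M. i \<in> e}"
  unfolding bij_betw_def
proof
  show "inj_on (\<lambda>j. {i, j}) (partners M i)" unfolding inj_on_def by (auto simp: doubleton_eq_iff)
  show "(\<lambda>j. {i, j}) ` partners M i = {e \<in> M. i \<in> e}"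
  proof (intro equalityI subsetI)
    fix e assume e: "e \<in> {e \<in> M. i \<in> e}"
    then obtain x y where xy: "e = {x, y}" using assms by (blast elim: edgeE)
    then have "i = x \<or> i = y" using e by blast
    then obtain j where "e = {i, j}" using xy insert_commute[of x y "{}"] by metis
    then show "e \<in> (\<lambda>j. {i, j}) ` partners M i"
      using e unfolding partners_def by simp
  qed (auto simp: partners_def)
qed

lemma card_incident: "M \<subseteq> E \<Longrightarrow> card {e \<in> M. i \<in> e} = card (partners M i)"
  by (rule bij_betw_same_card[OF bij_betw_partners, symmetric])

lemma finite_partners: "M \<subseteq> E \<Longrightarrow> finite (partners M i)"
  using finite_V finite_subset[of "partners M i" V] edge_vertices
  unfolding partners_def by blast

lemma card_partners_le: "b_matching V E b M \<Longrightarrow> i \<in> V \<Longrightarrow> card (partners M i) \<le> b i"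
  using card_incident unfolding b_matching_def by metis

text \<open>Excludes the infinite utility of capacity 0 at the end points of edges of a
  b-matching.\<close>

lemma capacity_pos:
  assumes "b_matching V E b M" "{i, j} \<in> M"
  shows "0 < b i"
proof -
  have ME: "M \<subseteq> E" using assms(1) unfolding b_matching_def by blast
  then have "{i, j} \<in> E" using assms(2) by blast
  then have "card (partners M i) \<le> b i"
    using card_partners_le[OF assms(1)] edge_vertices(1) by blast
  moreover have "j \<in> partners M i" using assms(2) unfolding partners_def by simp
  then have "0 < card (partners M i)" using finite_partners[OF ME] card_gt_0_iff by blast
  ultimately show ?thesis by linarith
qed

text \<open>At a vertex of capacity 0 the utility is infinite and its real value is the junk value 0,
  which is the right dual price there, since no edge of a b-matching meets such a vertex.\<close>

definition real_utility :: "'v set set \<Rightarrow> ('v \<Rightarrow> 'v \<Rightarrow> real) \<Rightarrow> 'v \<Rightarrow> real" where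
  "real_utility M p i = real_of_ereal (utility b M p i)"

context
  fixes M p
  assumes sol: "sfp_solution V E b w M p"
begin

lemma sfp_matching: "b_matching V E b M" "M \<subseteq> E"
  using sol unfolding sfp_solution_def b_matching_def by blast+

lemma payoff:
  shows "i \<in> V \<Longrightarrow> j \<in> V \<Longrightarrow> 0 \<le> p i j"
    and "{i, j} \<in> M \<Longrightarrow> p i j + p j i = w {i, j}"
  using sol edge_vertices sfp_matching(2)
  unfolding sfp_solution_def compatible_payoff_def by blast+

lemma utility_nonneg: "i \<in> V \<Longrightarrow> 0 \<le> utility b M p i"
  using edge_vertices sfp_matching(2) payoff(1)
  unfolding utility_def partners_def by (auto intro!: INF_greatest simp: subset_iff)

text \<open>A saturated vertex of positive capacity has a partner, so the infimum lies between 0 and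
  a real payoff.\<close>

lemma utility_eq:
  assumes "i \<in> V" "0 < b i"
  shows "utility b M p i = ereal (real_utility M p i)"
proof (cases "saturated b M i")
  case True
  then obtain j where "j \<in> partners M i"
    using assms(2) card_incident[OF sfp_matching(2)] unfolding saturated_def
    by (metis card.empty ex_in_conv less_irrefl)
  then have "utility b M p i \<le> ereal (p i j)"
    using True unfolding utility_def by (auto intro: INF_lower)
  then have "\<bar>utility b M p i\<bar> \<noteq> \<infinity>" using utility_nonneg[OF assms(1)] by auto
  then show ?thesis by (simp add: real_utility_def ereal_real')
qed (simp add: utility_def real_utility_def)

lemma real_utility_nonneg: "i \<in> V \<Longrightarrow> 0 \<le> real_utility M p i"
  using utility_nonneg unfolding real_utility_def by (simp add: real_of_ereal_pos)

lemma utility_finite: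
  assumes "{i, j} \<in> M"
  shows "utility b M p i = ereal (real_utility M p i)"
  using utility_eq capacity_pos[OF sfp_matching(1) assms] edge_vertices sfp_matching(2) assms
  by blast

lemma real_utility_le:
  assumes "{i, j} \<in> M"
  shows "real_utility M p i \<le> p i j"
proof -
  have ij: "i \<in> V" "j \<in> V" using assms sfp_matching(2) edge_vertices by blast+
  have "utility b M p i \<le> ereal (p i j)"
    using assms payoff(1)[OF ij] unfolding utility_def partners_def
    by (auto intro: INF_lower)
  then show ?thesis using utility_finite[OF assms] by simp
qed

lemma real_utility_unsaturated: "\<not> saturated b M i \<Longrightarrow> real_utility M p i = 0"
  unfolding real_utility_def utility_def by simp

text \<open>Linear programming duality, with the utilities as prices \<open>y\<close>: every edge \<open>ij\<close> outside \<open>M\<close>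
  weighs at most \<open>y i + y j\<close> and every edge of \<open>M\<close> at least that much, while the total price
  of the end points of a b-matching is maximal for \<open>M\<close>, whose unsaturated vertices have price 0.\<close>

lemma max_weight_if_stable:
  assumes "sfp_stable_solution V E b w M p"
  shows "max_weight_b_matching V E b w M"
  unfolding max_weight_b_matching_def
proof (intro conjI allI impI)
  fix L assume L: "b_matching V E b L"
  have LE: "L \<subseteq> E" using L unfolding b_matching_def by blast
  have fin: "finite L" "finite M"
    using finite_subset[OF _ finite_E] LE sfp_matching(2) by blast+
  let ?y = "real_utility M p"
  \<comment> \<open>Double counting: each vertex contributes its price once for every edge of
    \<open>K\<close> at it.\<close>
  have swap: "(\<Sum>e\<in>K. sum ?y e) = (\<Sum>i\<in>V. real (card {e \<in> K. i \<in> e}) * ?y i)"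
    if "K \<subseteq> E" for K
  proof -
    have K: "finite K" using that finite_E finite_subset by blast
    have "(\<Sum>e\<in>K. sum ?y e) = (\<Sum>e\<in>K. \<Sum>i\<in>V. if i \<in> e then ?y i else 0)"
    proof (rule sum.cong[OF refl])
      fix e assume "e \<in> K"
      then have "V \<inter> e = e" using that by (auto elim: edgeE)
      then show "sum ?y e = (\<Sum>i\<in>V. if i \<in> e then ?y i else 0)"
        using sum.inter_restrict[OF finite_V, of ?y e] by simp
    qed
    also have "\<dots> = (\<Sum>i\<in>V. \<Sum>e\<in>K. if i \<in> e then ?y i else 0)"
      by (rule sum.swap)
    also have "\<dots> = (\<Sum>i\<in>V. real (card {e \<in> K. i \<in> e}) * ?y i)"
      using K by (intro sum.cong refl) (simp add: sum.If_cases Int_def)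
    finally show ?thesis .
  qed
  \<comment> \<open>No b-matching has a larger degree than \<open>M\<close> at a saturated vertex;
    elsewhere the price is 0.\<close>
  have "real (card {e \<in> L. i \<in> e}) * ?y i \<le> real (card {e \<in> M. i \<in> e}) * ?y i" if "i \<in> V" for i
  proof (cases "saturated b M i")
    case True
    then have "card {e \<in> L. i \<in> e} \<le> card {e \<in> M. i \<in> e}"
      using L that unfolding b_matching_def saturated_def by simp
    then show ?thesis using real_utility_nonneg[OF that] by (simp add: mult_right_mono)
  qed (simp add: real_utility_unsaturated)
  then have "(\<Sum>e\<in>L. sum ?y e) \<le> (\<Sum>e\<in>M. sum ?y e)"
    unfolding swap[OF LE] swap[OF sfp_matching(2)] by (rule sum_mono)
  \<comment> \<open>The common edges are cancelled because stability bounds weights by prices only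
    off \<open>M\<close>; on \<open>L \<inter> M\<close> the weight may exceed the price.\<close>
  then have Y: "(\<Sum>e\<in>L - M. sum ?y e) \<le> (\<Sum>e\<in>M - L. sum ?y e)"
    using fin sum.Int_Diff[of L "sum ?y" M] sum.Int_Diff[of M "sum ?y" L]
    by (simp add: Int_commute)
  have "w e \<le> sum ?y e" if e: "e \<in> L - M" for e
  proof -
    obtain i j where ij: "e = {i, j}" "i \<in> V" "j \<in> V" "i \<noteq> j" using e LE by (blast elim: edgeE)
    \<comment> \<open>As \<open>L\<close> uses \<open>ij\<close>, both capacities are positive and
      the stability inequality is one between reals.\<close>
    then have "0 < b i" "0 < b j"
      using e capacity_pos[OF L, of i j] capacity_pos[OF L, of j i] by (auto simp: insert_commute)
    then have u: "utility b M p i = ereal (?y i)" "utility b M p j = ereal (?y j)"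
      using utility_eq ij by blast+
    have "ereal (w {i, j}) \<le> utility b M p i + utility b M p j"
      using assms e ij LE unfolding sfp_stable_solution_def by blast
    then show ?thesis using u ij by simp
  qed
  then have "sum w (L - M) \<le> (\<Sum>e\<in>L - M. sum ?y e)" by (rule sum_mono)
  also note Y
  also have "(\<Sum>e\<in>M - L. sum ?y e) \<le> sum w (M - L)"
  proof (rule sum_mono)
    fix e assume e: "e \<in> M - L"
    then obtain i j where ij: "e = {i, j}" "i \<noteq> j" using sfp_matching(2) by (blast elim: edgeE)
    then have "?y i \<le> p i j" "?y j \<le> p j i" "p i j + p j i = w e"
      using e real_utility_le[of i j] real_utility_le[of j i] payoff(2)
      by (auto simp: insert_commute)
    then show "sum ?y e \<le> w e" using ij by simp
  qed
  finally show "sum w L \<le> sum w M"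
    using fin sum.Int_Diff[of L w M] sum.Int_Diff[of M w L] by (simp add: Int_commute)
qed (fact sfp_matching(1))

end

text \<open>Reduces conditions on arbitrary vertex pairs to the three edge shapes of
  \<open>red_edges\<close>; \<open>transfer\<close> absorbs the two orders in which an edge can be
  written.\<close>

lemma srp_solutionI:
  assumes "b_matching V' E' (\<lambda>_. 1) M'" "\<And>x. x \<in> V' \<Longrightarrow> 0 \<le> p' x"
    and "\<And>i j s. {Copy i s, BarHalf i j} \<in> M' \<Longrightarrow> s \<in> {1..b i} \<Longrightarrow>
      p' (Copy i s) + p' (BarHalf i j) = w {i, j}"
    and "\<And>i j. {BarHalf i j, Half i j} \<in> M' \<Longrightarrow> p' (BarHalf i j) + p' (Half i j) = w {i, j}"
    and "\<And>i j. {Half i j, Half j i} \<in> M' \<Longrightarrow> p' (Half i j) + p' (Half j i) = w {i, j}"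
    and "\<And>x. x \<in> V' \<Longrightarrow> x \<notin> \<Union>M' \<Longrightarrow> p' x = 0"
  shows "srp_solution V' E' w' M' p'"
proof -
  have "p' x + p' y = w' {x, y}" if xy: "{x, y} \<in> M'" for x y
  proof -
    have transfer: "p' x + p' y = w' {x, y}"
      if "{x, y} = {u, v}" "p' u + p' v = w' {u, v}" for u v
      using that by (auto simp: doubleton_eq_iff insert_commute)
    have "{x, y} \<in> E'" using xy assms(1) unfolding b_matching_def by blast
    then show ?thesis
    proof (cases rule: red_edges_memE)
      case (copy i j s)
      then show ?thesis using transfer[OF copy(3)] assms(3)[of i s j] xy by simp
    next
      case (bar i j)
      then show ?thesis using transfer[OF bar(2)] assms(4)[of i j] xy by simp
    next
      case (half i j)
      then show ?thesis using transfer[OF half(2)] assms(5)[of i j] xy by simp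
    qed
  qed
  then show ?thesis unfolding srp_solution_def using assms(1,2,6) by blast
qed

lemma srp_stable_solutionI:
  assumes "srp_solution V' E' w' M' p'"
    and "\<And>i j s. {i, j} \<in> E \<Longrightarrow> s \<in> {1..b i} \<Longrightarrow> w {i, j} \<le> p' (Copy i s) + p' (BarHalf i j)"
    and "\<And>i j. {i, j} \<in> E \<Longrightarrow> w {i, j} \<le> p' (BarHalf i j) + p' (Half i j)"
    and "\<And>i j. {i, j} \<in> E \<Longrightarrow> w {i, j} \<le> p' (Half i j) + p' (Half j i)"
  shows "srp_stable_solution V' E' w' M' p'"
proof -
  have "w' {x, y} \<le> p' x + p' y" if xy: "{x, y} \<in> E'" for x y
  proof -
    have transfer: "w' {x, y} \<le> p' x + p' y"
      if "{x, y} = {u, v}" "w' {u, v} \<le> p' u + p' v" for u v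
      using that by (auto simp: doubleton_eq_iff insert_commute)
    from xy show ?thesis
    proof (cases rule: red_edges_memE)
      case (copy i j s)
      then show ?thesis using transfer[OF copy(3)] assms(2)[of i j s] by simp
    next
      case (bar i j)
      then show ?thesis using transfer[OF bar(2)] assms(3)[of i j] by simp
    next
      case (half i j)
      then show ?thesis using transfer[OF half(2)] assms(4)[of i j] by simp
    qed
  qed
  then show ?thesis unfolding srp_stable_solution_def using assms(1) by blast
qed

text \<open>On edges of \<open>M'\<close> the payoffs add up to the weight, so the stability
  inequality is available on every edge.\<close>

lemma srp_stable_le:
  assumes "srp_stable_solution V' E' w' M' p'" "{x, y} \<in> E'"
  shows "w' {x, y} \<le> p' x + p' y"
  using assms unfolding srp_stable_solution_def srp_solution_def
  by (cases "{x, y} \<in> M'") auto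

lemma partner_orders_exist:
  assumes "M \<subseteq> E"
  shows "\<exists>pos. partner_orders V M pos"
proof -
  have "\<exists>f. bij_betw f (partners M i) {1..card (partners M i)}" for i
    using ex_bij_betw_nat_finite_1[OF finite_partners[OF assms]] bij_betw_inv by blast
  then show ?thesis unfolding partner_orders_def by metis
qed

subsection \<open>From the instance to the reduced instance\<close>

text \<open>A predicate form of the set in \<open>reduced_matching\<close> with the order explicit:
  whether a given edge belongs to it is then settled by comparing constructors.\<close>

definition reduced_edge :: "'v set set \<Rightarrow> ('v \<Rightarrow> 'v \<Rightarrow> nat) \<Rightarrow> 'v rvertex set \<Rightarrow> bool" where
  "reduced_edge M pos e \<longleftrightarrow>
     (\<exists>i j. e = {Copy i (pos i j), BarHalf i j} \<and> {i, j} \<in> M) \<or>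
     (\<exists>i j. e = {Half i j, Half j i} \<and> {i, j} \<in> M) \<or>
     (\<exists>i j. e = {BarHalf i j, Half i j} \<and> {i, j} \<in> E - M)"

section \<open>Shape of a reduced matching\<close>

context
  fixes M M'
  assumes M: "b_matching V E b M" and red: "reduced_matching V E M M'"
begin

lemma reduced_matching_orders:
  "\<exists>pos. partner_orders V M pos \<and> (\<forall>e. e \<in> M' \<longleftrightarrow> reduced_edge M pos e)"
proof -
  obtain pos where pos: "partner_orders V M pos"
    and M': "M' = {{Copy i (pos i j), BarHalf i j} | i j. {i, j} \<in> M} \<union>
             {{Half i j, Half j i} | i j. {i, j} \<in> M} \<union>
             {{BarHalf i j, Half i j} | i j. {i, j} \<in> E - M}"
    using red unfolding reduced_matching_def by blast
  have "\<forall>e. e \<in> M' \<longleftrightarrow> reduced_edge M pos e"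
    by (simp only: M' reduced_edge_def Un_iff mem_Collect_eq disj_assoc simp_thms)
  then show ?thesis using pos by blast
qed

lemma reduced_Copy_BarHalf_memD:
  assumes "{Copy i s, BarHalf i j} \<in> M'"
  shows "{i, j} \<in> M"
proof -
  obtain pos where "\<And>e. e \<in> M' \<longleftrightarrow> reduced_edge M pos e"
    using reduced_matching_orders by blast
  then show ?thesis using assms by (simp add: reduced_edge_def doubleton_eq_iff)
qed

lemma reduced_BarHalf_Half_mem_iff: "{BarHalf i j, Half i j} \<in> M' \<longleftrightarrow> {i, j} \<in> E - M"
proof -
  obtain pos where "\<And>e. e \<in> M' \<longleftrightarrow> reduced_edge M pos e"
    using reduced_matching_orders by blast
  then show ?thesis by (simp add: reduced_edge_def doubleton_eq_iff)
qed

lemma reduced_Half_Half_mem_iff: "{Half i j, Half j i} \<in> M' \<longleftrightarrow> {i, j} \<in> M"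
proof -
  obtain pos where "\<And>e. e \<in> M' \<longleftrightarrow> reduced_edge M pos e"
    using reduced_matching_orders by blast
  then have "{Half i j, Half j i} \<in> M' \<longleftrightarrow> {i, j} \<in> M \<or> {j, i} \<in> M"
    by (simp add: reduced_edge_def doubleton_eq_iff conj_disj_distribR ex_disj_distrib)
  then show ?thesis by (simp add: insert_commute)
qed

text \<open>The position of \<open>j\<close> among the partners of \<open>i\<close> is at most their
  number, hence at most \<open>b i\<close>.\<close>

lemma reduced_Copy_BarHalf_memE:
  assumes "{i, j} \<in> M"
  obtains s where "s \<in> {1..b i}" "{Copy i s, BarHalf i j} \<in> M'"
proof -
  obtain pos where pos: "partner_orders V M pos" and mem: "\<And>e. e \<in> M' \<longleftrightarrow> reduced_edge M pos e"
    using reduced_matching_orders by blast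
  have i: "i \<in> V" using assms M edge_vertices(1) unfolding b_matching_def by blast
  have "j \<in> partners M i" using assms unfolding partners_def by simp
  then have "pos i j \<in> {1..card (partners M i)}"
    using pos i bij_betwE unfolding partner_orders_def by blast
  then have "pos i j \<in> {1..b i}" using card_partners_le[OF M i] by simp
  moreover have "{Copy i (pos i j), BarHalf i j} \<in> M'"
    using assms unfolding mem reduced_edge_def by blast
  ultimately show thesis by (rule that)
qed

text \<open>At a saturated vertex the positions exhaust \<open>{1..b i}\<close>. Hence an uncovered
  copy belongs to an unsaturated vertex, whose utility is 0.\<close>

lemma reduced_Copy_covered:
  assumes "i \<in> V" "saturated b M i" "s \<in> {1..b i}"
  shows "\<exists>j. {i, j} \<in> M \<and> {Copy i s, BarHalf i j} \<in> M'"
proof -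
  obtain pos where pos: "partner_orders V M pos" and mem: "\<And>e. e \<in> M' \<longleftrightarrow> reduced_edge M pos e"
    using reduced_matching_orders by blast
  have "card (partners M i) = b i"
    using assms(2) M card_incident unfolding saturated_def b_matching_def by metis
  then have "bij_betw (pos i) (partners M i) {1..b i}"
    using pos assms(1) unfolding partner_orders_def by metis
  then have "s \<in> pos i ` partners M i" using assms(3) unfolding bij_betw_def by simp
  then obtain j where "{i, j} \<in> M" "pos i j = s" unfolding partners_def by blast
  then show ?thesis unfolding mem reduced_edge_def by blast
qed

text \<open>A copy lies on at most one edge because \<open>pos i\<close> is injective; which edge
  meets \<open>Half i j\<close> or \<open>BarHalf i j\<close> is decided by whether
  \<open>ij\<close> is in \<open>M\<close>.\<close>

lemma b_matching_reduced: "b_matching V' E' (\<lambda>_. 1) M'"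
proof -
  obtain pos where pos: "partner_orders V M pos" and mem: "\<And>e. e \<in> M' \<longleftrightarrow> reduced_edge M pos e"
    using reduced_matching_orders by blast
  have ME: "M \<subseteq> E" using M unfolding b_matching_def by blast
  have M'E': "M' \<subseteq> E'"
  proof
    fix e assume "e \<in> M'"
    then consider i j where "{i, j} \<in> M" "e = {Copy i (pos i j), BarHalf i j}"
      | i j where "{i, j} \<in> M" "e = {Half i j, Half j i}"
      | i j where "{i, j} \<in> E - M" "e = {BarHalf i j, Half i j}"
      unfolding mem reduced_edge_def by metis
    then show "e \<in> E'"
    proof cases
      case (1 i j)
      \<comment> \<open>The copy found here must be number \<open>pos i j\<close>, which passes the
        bound by \<open>b i\<close> on to that position.\<close>
      obtain s where s: "s \<in> {1..b i}" "{Copy i s, BarHalf i j} \<in> M'"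
        using reduced_Copy_BarHalf_memE[OF 1(1)] .
      have "s = pos i j" using s(2) by (simp add: mem reduced_edge_def doubleton_eq_iff)
      then show ?thesis using red_edges_memI(1)[OF subsetD[OF ME 1(1)], of s b] s(1) 1(2) by simp
    next
      case 2
      then show ?thesis using red_edges_memI(3)[OF subsetD[OF ME 2(1)]] by simp
    next
      case 3
      then show ?thesis using red_edges_memI(2)[OF DiffD1[OF 3(1)]] by simp
    qed
  qed
  have unique: "e = f" if "e \<in> M'" "f \<in> M'" "v \<in> e" "v \<in> f" "v \<in> V'" for e f v
  proof (cases v)
    case (Copy i s)
    have i: "i \<in> V" using that(5) Copy unfolding red_vertices_def by simp
    then have inj: "inj_on (pos i) (partners M i)"
      using pos unfolding partner_orders_def bij_betw_def by blast
    have at: "\<exists>j\<in>partners M i. s = pos i j \<and> g = {Copy i (pos i j), BarHalf i j}"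
      if "g \<in> M'" "v \<in> g" for g
      using that Copy unfolding mem reduced_edge_def partners_def by auto
    show ?thesis using at[OF that(1,3)] at[OF that(2,4)] inj unfolding inj_on_def by blast
  next
    case (Half i j)
    have at: "g = (if {i, j} \<in> M then {Half i j, Half j i} else {BarHalf i j, Half i j})"
      if "g \<in> M'" "v \<in> g" for g
      using that Half unfolding mem reduced_edge_def by (auto simp: insert_commute)
    show ?thesis using at[OF that(1,3)] at[OF that(2,4)] by simp
  next
    case (BarHalf i j)
    have at: "g = (if {i, j} \<in> M then {Copy i (pos i j), BarHalf i j} else {BarHalf i j, Half i j})"
      if "g \<in> M'" "v \<in> g" for g
      using that BarHalf unfolding mem reduced_edge_def by auto
    show ?thesis using at[OF that(1,3)] at[OF that(2,4)] by simp
  qed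
  have "finite M'" using M'E' finite_red_edges by (rule finite_subset)
  then have "card {e \<in> M'. v \<in> e} \<le> Suc 0" if "v \<in> V'" for v
    using unique[OF _ _ _ _ that] card_le_Suc0_iff_eq[of "{e \<in> M'. v \<in> e}"] by fastforce
  then show ?thesis unfolding b_matching_def using M'E' by simp
qed

end

lemma reduced_solution_exists:
  assumes sol: "sfp_solution V E b w M p"
  shows "\<exists>M' p'. reduced_solution V E b w M p M' p'"
proof -
  \<comment> \<open>Even where the utility is infinite, its minimum with the weight is real, so a
    real-valued \<open>p'\<close> exists.\<close>
  have "\<exists>m. \<forall>i j. {i, j} \<in> E \<longrightarrow> ereal (m i j) = min (utility b M p i) (ereal (w {i, j}))"
  proof (intro exI allI impI)
    fix i j assume "{i, j} \<in> E"
    then show "ereal (real_of_ereal (min (utility b M p i) (ereal (w {i, j}))))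
        = min (utility b M p i) (ereal (w {i, j}))"
      using utility_nonneg[OF sol, of i] edge_vertices(1) by (intro ereal_real') (auto simp: min_def)
  qed
  then obtain m where m: "{i, j} \<in> E \<Longrightarrow> min (utility b M p i) (ereal (w {i, j})) = ereal (m i j)" for i j
    by metis
  obtain M' where "reduced_matching V E M M'"
    using partner_orders_exist[OF sfp_matching(2)[OF sol]] unfolding reduced_matching_def by blast
  \<comment> \<open>The junk value of \<open>real_utility\<close> does not enter the required
    equations: copies and matched edges occur only at vertices of positive capacity.\<close>
  moreover define p' where "p' = (\<lambda>x. case x of Copy i s \<Rightarrow> real_utility M p i
      | Half i j \<Rightarrow> if {i, j} \<in> M then p i j else m i j
      | BarHalf i j \<Rightarrow> w {i, j} - (if {i, j} \<in> M then real_utility M p i else m i j))"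
  ultimately have "reduced_solution V E b w M p M' p'"
    unfolding reduced_solution_def
    using utility_eq[OF sol] utility_finite[OF sol] by (simp add: m)
  then show ?thesis by blast
qed

section \<open>Payoffs of a reduced pair: feasibility and stability\<close>

context
  fixes M p M' p'
  assumes sol: "sfp_solution V E b w M p" and red: "reduced_solution V E b w M p M' p'"
begin

lemma reduced_matching: "reduced_matching V E M M'"
  using red unfolding reduced_solution_def by blast

lemma reduced_payoff_Copy:
  assumes "i \<in> V" "s \<in> {1..b i}"
  shows "p' (Copy i s) = real_utility M p i"
proof -
  have "ereal (p' (Copy i s)) = utility b M p i"
    using red assms by (simp add: reduced_solution_def)
  then show ?thesis unfolding real_utility_def by (metis real_of_ereal.simps(1))
qed

lemma reduced_payoff_matched:
  assumes "{i, j} \<in> M"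
  shows "p' (Half i j) = p i j" "p' (BarHalf i j) = w {i, j} - real_utility M p i"
proof -
  have "ereal (p' (BarHalf i j)) = ereal (w {i, j}) - utility b M p i"
    using red assms by (simp add: reduced_solution_def)
  then show "p' (BarHalf i j) = w {i, j} - real_utility M p i"
    using utility_finite[OF sol assms] by simp
  show "p' (Half i j) = p i j" using red assms by (simp add: reduced_solution_def)
qed

lemma reduced_payoff_unmatched:
  assumes "{i, j} \<in> E - M"
  shows "ereal (p' (Half i j)) = min (utility b M p i) (ereal (w {i, j}))"
    and "p' (BarHalf i j) = w {i, j} - p' (Half i j)"
    and "0 \<le> p' (Half i j)" "p' (Half i j) \<le> w {i, j}"
proof -
  show half: "ereal (p' (Half i j)) = min (utility b M p i) (ereal (w {i, j}))"
    using red assms by (simp add: reduced_solution_def)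
  have "ereal (p' (BarHalf i j)) = ereal (w {i, j}) - min (utility b M p i) (ereal (w {i, j}))"
    using red assms by (simp add: reduced_solution_def)
  then show "p' (BarHalf i j) = w {i, j} - p' (Half i j)" unfolding half[symmetric] by simp
  have "0 \<le> ereal (p' (Half i j))"
    unfolding half using utility_nonneg[OF sol] edge_vertices weight_nonneg assms by auto
  then show "0 \<le> p' (Half i j)" by simp
  have "ereal (p' (Half i j)) \<le> ereal (w {i, j})" unfolding half by (rule min.cobounded2)
  then show "p' (Half i j) \<le> w {i, j}" by simp
qed

text \<open>Barred payoffs are complements that make the edges of \<open>M'\<close> tight. They are
  nonnegative because the utility is at most \<open>p i j \<le> w {i, j}\<close> on matched edges,
  and by truncation at the weight on the others. Only copies can be uncovered, and only at
  unsaturated vertices.\<close>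

lemma srp_solution_reduced: "srp_solution V' E' w' M' p'"
proof (rule srp_solutionI)
  note B = sfp_matching(1)[OF sol] and ME = sfp_matching(2)[OF sol]
  note R = reduced_matching
  show "b_matching V' E' (\<lambda>_. 1) M'" using b_matching_reduced[OF B R] .
  fix i j s
  show "p' (Copy i s) + p' (BarHalf i j) = w {i, j}"
    if "{Copy i s, BarHalf i j} \<in> M'" "s \<in> {1..b i}"
  proof -
    have "{i, j} \<in> M" using reduced_Copy_BarHalf_memD[OF B R that(1)] .
    then show ?thesis
      using reduced_payoff_Copy[OF _ that(2)] reduced_payoff_matched(2)[of i j] edge_vertices(1)[of i j] ME
      by auto
  qed
  show "p' (BarHalf i j) + p' (Half i j) = w {i, j}" if "{BarHalf i j, Half i j} \<in> M'"
    using that reduced_payoff_unmatched(2)[of i j] reduced_BarHalf_Half_mem_iff[OF B R] by simp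
  show "p' (Half i j) + p' (Half j i) = w {i, j}" if "{Half i j, Half j i} \<in> M'"
    using that reduced_payoff_matched(1)[of i j] reduced_payoff_matched(1)[of j i]
      payoff(2)[OF sol, of i j] reduced_Half_Half_mem_iff[OF B R] by (simp add: insert_commute)
next
  note B = sfp_matching(1)[OF sol] and ME = sfp_matching(2)[OF sol]
  note R = reduced_matching
  fix x assume "x \<in> V'"
  then consider (copy) i s where "x = Copy i s" "i \<in> V" "s \<in> {1..b i}"
    | (half) i j where "x = Half i j" "{i, j} \<in> E" | (bar) i j where "x = BarHalf i j" "{i, j} \<in> E"
    unfolding red_vertices_def by blast
  note cases = this
  show "0 \<le> p' x" using cases
  proof cases
    case (copy i s)
    then show ?thesis using reduced_payoff_Copy real_utility_nonneg[OF sol] by simp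
  next
    case (half i j)
    then show ?thesis
      using reduced_payoff_matched(1)[of i j] reduced_payoff_unmatched(3)[of i j]
        payoff(1)[OF sol] edge_vertices[of i j] by (cases "{i, j} \<in> M") auto
  next
    case (bar i j)
    show ?thesis
    proof (cases "{i, j} \<in> M")
      case True
      then have "real_utility M p i \<le> p i j" "0 \<le> p j i" "p i j + p j i = w {i, j}"
        using real_utility_le[OF sol] payoff[OF sol] edge_vertices[OF bar(2)] by blast+
      then show ?thesis using bar reduced_payoff_matched(2)[OF True] by simp
    next
      case False
      then show ?thesis
        using bar reduced_payoff_unmatched(2)[of i j] reduced_payoff_unmatched(4)[of i j] by simp
    qed
  qed
  show "p' x = 0" if un: "x \<notin> \<Union>M'" using cases
  proof cases
    case (copy i s)
    have "\<not> saturated b M i" using reduced_Copy_covered[OF B R copy(2) _ copy(3)] un copy(1) by blast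
    then show ?thesis using copy reduced_payoff_Copy real_utility_unsaturated[OF sol] by simp
  next
    case (half i j)
    then have "{Half i j, Half j i} \<in> M' \<or> {BarHalf i j, Half i j} \<in> M'"
      using reduced_BarHalf_Half_mem_iff[OF B R] reduced_Half_Half_mem_iff[OF B R] by blast
    then show ?thesis using un half(1) by blast
  next
    case (bar i j)
    then have "(\<exists>s. {Copy i s, BarHalf i j} \<in> M') \<or> {BarHalf i j, Half i j} \<in> M'"
      using reduced_BarHalf_Half_mem_iff[OF B R] reduced_Copy_BarHalf_memE[OF B R] by blast
    then show ?thesis using un bar(1) by blast
  qed
qed

lemma srp_stable_reduced:
  assumes stable: "sfp_stable_solution V E b w M p"
  shows "srp_stable_solution V' E' w' M' p'"
proof (rule srp_stable_solutionI[OF srp_solution_reduced])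
  fix i j s assume ij: "{i, j} \<in> E"
  note V = edge_vertices[OF ij]
  show "w {i, j} \<le> p' (Copy i s) + p' (BarHalf i j)" if s: "s \<in> {1..b i}"
  proof (cases "{i, j} \<in> M")
    case True
    then show ?thesis using reduced_payoff_Copy[OF V(1) s] reduced_payoff_matched(2) by simp
  next
    case False
    then have un: "{i, j} \<in> E - M" using ij by blast
    \<comment> \<open>The copy \<open>s\<close> witnesses \<open>0 < b i\<close>, so the utility is
      finite.\<close>
    have "utility b M p i = ereal (real_utility M p i)" using utility_eq[OF sol V(1)] s by simp
    then have "ereal (p' (Half i j)) \<le> ereal (real_utility M p i)"
      using reduced_payoff_unmatched(1)[OF un] min.cobounded1 by metis
    then show ?thesis using reduced_payoff_Copy[OF V(1) s] reduced_payoff_unmatched(2)[OF un] by simp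
  qed
  show "w {i, j} \<le> p' (BarHalf i j) + p' (Half i j)"
  proof (cases "{i, j} \<in> M")
    case True
    then show ?thesis using reduced_payoff_matched real_utility_le[OF sol] by simp
  qed (use ij reduced_payoff_unmatched(2) in simp)
  show "w {i, j} \<le> p' (Half i j) + p' (Half j i)"
  proof (cases "{i, j} \<in> M")
    case True
    moreover from this have "{j, i} \<in> M" by (simp add: insert_commute)
    ultimately show ?thesis using reduced_payoff_matched(1) payoff(2)[OF sol] by simp
  next
    case False
    then have un: "{i, j} \<in> E - M" "{j, i} \<in> E - M" using ij by (simp_all add: insert_commute)
    have "ereal (w {i, j}) \<le> utility b M p i + utility b M p j"
      using stable un(1) unfolding sfp_stable_solution_def by blast
    \<comment> \<open>Truncation keeps the sum large enough: a truncated summand equals the weight,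
      and the other one is nonnegative.\<close>
    then have "ereal (w {i, j}) \<le> min (utility b M p i) (ereal (w {i, j}))
        + min (utility b M p j) (ereal (w {j, i}))"
      using utility_nonneg[OF sol V(1)] utility_nonneg[OF sol V(2)] weight_nonneg[OF ij]
      by (auto simp: min_def insert_commute add_increasing add_increasing2)
    then show ?thesis unfolding reduced_payoff_unmatched(1)[OF un(1), symmetric]
        reduced_payoff_unmatched(1)[OF un(2), symmetric] by simp
  qed
qed

end

subsection \<open>From the reduced instance back to the instance\<close>

text \<open>A stable \<open>M'\<close> need not have the shape of a reduced matching: it may contain
  the middle edge of a gadget while a barred vertex is uncovered. Demanding copies at both ends
  bounds the degrees by \<open>b\<close>.\<close>

definition extracted :: "'v rvertex set set \<Rightarrow> 'v set set" where
  "extracted M' = {{i, j} | i j. {Half i j, Half j i} \<in> M' \<and>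
     (\<exists>s. {Copy i s, BarHalf i j} \<in> M') \<and> (\<exists>t. {Copy j t, BarHalf j i} \<in> M')}"

text \<open>Unfolding yields the condition for one of the two orientations of \<open>{i, j}\<close>;
  it is symmetric, so either orientation will do.\<close>

lemma extracted_mem_iff:
  "{i, j} \<in> extracted M' \<longleftrightarrow> {Half i j, Half j i} \<in> M' \<and>
     (\<exists>s. {Copy i s, BarHalf i j} \<in> M') \<and> (\<exists>t. {Copy j t, BarHalf j i} \<in> M')"
proof -
  let ?Q = "\<lambda>i j. {Half i j, Half j i} \<in> M' \<and>
     (\<exists>s. {Copy i s, BarHalf i j} \<in> M') \<and> (\<exists>t. {Copy j t, BarHalf j i} \<in> M')"
  have "?Q i j \<longleftrightarrow> ?Q j i" for i j by (auto simp: insert_commute)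
  moreover have "{i, j} \<in> extracted M' \<longleftrightarrow> ?Q i j \<or> ?Q j i"
    unfolding extracted_def mem_Collect_eq doubleton_eq_iff by blast
  ultimately show ?thesis by blast
qed

text \<open>Carries facts about \<open>extracted M'\<close> over to a b-matching from which
  \<open>M'\<close> is reduced. The gadget of a matched edge has all required edges; any other
  gadget lacks the middle one.\<close>

lemma extracted_reduced:
  assumes M: "b_matching V E b M" and red: "reduced_matching V E M M'"
  shows "extracted M' = M"
proof -
  have iff: "{i, j} \<in> extracted M' \<longleftrightarrow> {i, j} \<in> M" for i j
    unfolding extracted_mem_iff reduced_Half_Half_mem_iff[OF M red]
    using reduced_Copy_BarHalf_memE[OF M red, of i j] reduced_Copy_BarHalf_memE[OF M red, of j i]
    by (metis insert_commute)
  have "M \<subseteq> E" using M unfolding b_matching_def by blast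
  then have pair: "\<exists>i j. e = {i, j}" if "e \<in> M" for e using that by (blast elim: edgeE)
  show ?thesis
  proof (intro equalityI subsetI)
    fix e assume e: "e \<in> extracted M'"
    then obtain i j where "e = {i, j}" unfolding extracted_def by blast
    then show "e \<in> M" using e iff by simp
  next
    fix e assume e: "e \<in> M"
    then obtain i j where "e = {i, j}" using pair by blast
    then show "e \<in> extracted M'" using e iff by simp
  qed
qed

section \<open>From a stable solution of the reduced instance to one of the original\<close>

context
  fixes M' p'
  assumes stable: "srp_stable_solution V' E' w' M' p'"
begin

lemma srp_matching: "b_matching V' E' (\<lambda>_. 1) M'" "M' \<subseteq> E'"
  using stable unfolding srp_stable_solution_def srp_solution_def b_matching_def by blast+

lemma srp_payoff:
  shows "x \<in> V' \<Longrightarrow> 0 \<le> p' x"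
    and "x \<in> V' \<Longrightarrow> x \<notin> \<Union>M' \<Longrightarrow> p' x = 0"
    and "{x, y} \<in> M' \<Longrightarrow> p' x + p' y = w' {x, y}"
  using stable unfolding srp_stable_solution_def srp_solution_def by blast+

text \<open>If the gadget of an edge outside \<open>extracted M'\<close> uses copies of its end points, these have
  payoff 0. So \<open>M'\<close> could be replaced inside the gadget by the pattern for an unmatched edge
  while keeping \<open>p'\<close>.\<close>

lemma gadget_half:
  assumes ij: "{i, j} \<in> E" and un: "{i, j} \<notin> extracted M'"
  shows "p' (BarHalf i j) + p' (Half i j) = w {i, j}"
    and "{Copy i s, BarHalf i j} \<in> M' \<Longrightarrow> p' (Copy i s) = 0"
proof -
  have ji: "{j, i} \<in> E" using ij by (simp add: insert_commute)
  have wji: "w {j, i} = w {i, j}" by (simp add: insert_commute)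
  have HHji: "{Half j i, Half i j} = {Half i j, Half j i}" by (simp add: insert_commute)
  note V = red_vertices_memI(2,3)[OF ij] red_vertices_memI(2,3)[OF ji]
  note same = red_matching_unique[OF srp_matching(1)]
  have le: "w {i, j} \<le> p' (Half i j) + p' (Half j i)"
    "w {i, j} \<le> p' (BarHalf i j) + p' (Half i j)"
    "w {i, j} \<le> p' (BarHalf j i) + p' (Half j i)"
    using srp_stable_le[OF stable red_edges_memI(3)[OF ij]]
      srp_stable_le[OF stable red_edges_memI(2)[OF ij]]
      srp_stable_le[OF stable red_edges_memI(2)[OF ji]] wji by simp_all
  have nonneg: "0 \<le> p' (Half i j)" "0 \<le> p' (BarHalf i j)"
    "0 \<le> p' (Half j i)" "0 \<le> p' (BarHalf j i)"
    using V srp_payoff(1) by blast+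
  have HH: "p' (Half i j) + p' (Half j i) = w {i, j}" if "{Half i j, Half j i} \<in> M'"
    using srp_payoff(3)[OF that] by simp
  have BH: "p' (BarHalf i j) + p' (Half i j) = w {i, j}" if "{BarHalf i j, Half i j} \<in> M'"
    using srp_payoff(3)[OF that] by simp
  have CB: "p' (Copy i s) + p' (BarHalf i j) = w {i, j}" "0 \<le> p' (Copy i s)"
    if "{Copy i s, BarHalf i j} \<in> M'" for s
  proof -
    have "{Copy i s, BarHalf i j} \<in> E'" using that srp_matching(2) by (rule subsetD[rotated])
    then have "Copy i s \<in> V'"
      using Copy_BarHalf_mem_red_edgesD(2) red_vertices_memI(1) edge_vertices(1)[OF ij] by metis
    then show "0 \<le> p' (Copy i s)" by (rule srp_payoff(1))
  qed (use srp_payoff(3)[OF that] in simp)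
  have H0: "p' (Half i j) = 0"
    if "{Half i j, Half j i} \<notin> M'" "{BarHalf i j, Half i j} \<notin> M'"
  proof (rule srp_payoff(2)[OF V(1)])
    show "Half i j \<notin> \<Union>M'"
      using that red_edge_at_Half srp_matching(2) by (metis UnionE subsetD)
  qed
  \<comment> \<open>Stated for general \<open>k\<close> and \<open>l\<close> because it is applied
    at both ends of the gadget.\<close>
  have B0: "p' (BarHalf k l) = 0"
    if "{k, l} \<in> E" "\<forall>s. {Copy k s, BarHalf k l} \<notin> M'" "{BarHalf k l, Half k l} \<notin> M'" for k l
  proof (rule srp_payoff(2)[OF red_vertices_memI(3)[OF that(1)]])
    show "BarHalf k l \<notin> \<Union>M'"
      using that(2,3) red_edge_at_BarHalf srp_matching(2) by (metis UnionE subsetD)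
  qed
  have HH_excl: "{BarHalf j i, Half j i} \<notin> M'" if "{Half i j, Half j i} \<in> M'"
    using same[OF that _ _ _ V(3), of "{BarHalf j i, Half j i}"] by (auto simp: doubleton_eq_iff)
  have BH_excl: "{Copy i s, BarHalf i j} \<notin> M'" if "{BarHalf i j, Half i j} \<in> M'" for s
    using same[OF that _ _ _ V(2), of "{Copy i s, BarHalf i j}"] by (auto simp: doubleton_eq_iff)
  have goal: "p' (BarHalf i j) + p' (Half i j) = w {i, j} \<and>
    ({Copy i s, BarHalf i j} \<in> M' \<longrightarrow> p' (Copy i s) = 0)" for s
  proof (cases "{BarHalf i j, Half i j} \<in> M'")
    case True
    then show ?thesis using BH BH_excl by blast
  next
    case no_BH: False
    show ?thesis
    proof (cases "{Half i j, Half j i} \<in> M'")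
      case HH': True
      show ?thesis
      proof (cases "\<exists>s. {Copy i s, BarHalf i j} \<in> M'")
        case True
        \<comment> \<open>As \<open>ij\<close> is not extracted and \<open>Half j i\<close> is
          taken, \<open>BarHalf j i\<close> is uncovered. Its payoff 0 forces
          \<open>p' (Half j i) = w {i, j}\<close>, hence \<open>p' (Half i j) = 0\<close>, and
          stability gives \<open>BarHalf i j\<close> the whole weight, leaving 0 for the
          copy.\<close>
        then have "\<forall>t. {Copy j t, BarHalf j i} \<notin> M'"
          using un HH' unfolding extracted_mem_iff by blast
        then have "p' (BarHalf j i) = 0" using B0[OF ji] HH_excl[OF HH'] by blast
        then have "p' (Half i j) = 0" "w {i, j} \<le> p' (BarHalf i j)"
          using HH[OF HH'] le nonneg by linarith+
        moreover obtain s' where "{Copy i s', BarHalf i j} \<in> M'" using True by blast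
        ultimately show ?thesis using CB[of s'] CB[of s] by fastforce
      next
        case False
        \<comment> \<open>\<open>Half i j\<close> then gets exactly the weight: at least that by
          stability, at most that because the middle edge is tight.\<close>
        then have "p' (BarHalf i j) = 0" using B0[OF ij] no_BH by blast
        then have "p' (Half i j) = w {i, j}" using le(2) HH[OF HH'] nonneg by linarith
        then show ?thesis using False \<open>p' (BarHalf i j) = 0\<close> by simp
      qed
    next
      case False
      \<comment> \<open>Here \<open>Half i j\<close> is uncovered, so the barred vertex needs at
        least the full weight; a copy matched to it is left with 0.\<close>
      then have half: "p' (Half i j) = 0" using H0 no_BH by blast
      show ?thesis
      proof (cases "\<exists>s. {Copy i s, BarHalf i j} \<in> M'")
        case True
        then obtain s' where "{Copy i s', BarHalf i j} \<in> M'" by blast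
        then show ?thesis using CB[of s'] CB[of s] half le(2) by fastforce
      next
        case False
        \<comment> \<open>With both vertices uncovered, stability of their edge forces the weight to
          be 0.\<close>
        then have "p' (BarHalf i j) = 0" using B0[OF ij] no_BH by blast
        then show ?thesis using False half le(2) weight_nonneg[OF ij] by simp
      qed
    qed
  qed
  show "p' (BarHalf i j) + p' (Half i j) = w {i, j}" using goal by blast
  show "{Copy i s, BarHalf i j} \<in> M' \<Longrightarrow> p' (Copy i s) = 0" using goal by blast
qed

lemma extracted_subset: "extracted M' \<subseteq> E"
proof
  fix e assume "e \<in> extracted M'"
  then obtain i j s where e: "e = {i, j}" "{Copy i s, BarHalf i j} \<in> M'"
    unfolding extracted_def by blast
  then have "{Copy i s, BarHalf i j} \<in> E'" using srp_matching(2) by blast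
  then show "e \<in> E" using e(1) Copy_BarHalf_mem_red_edgesD(1) by metis
qed

text \<open>A copy meets at most one edge of \<open>M'\<close>, so distinct partners use distinct
  copies. This bounds the degrees and provides a spare copy at an unsaturated vertex.\<close>

lemma copy_assignment:
  assumes i: "i \<in> V"
  obtains f where "inj_on f (partners (extracted M') i)"
    "\<And>j. j \<in> partners (extracted M') i \<Longrightarrow> f j \<in> {1..b i} \<and> {Copy i (f j), BarHalf i j} \<in> M'"
proof -
  have "\<forall>j\<in>partners (extracted M') i. \<exists>s. {Copy i s, BarHalf i j} \<in> M'"
    unfolding partners_def using extracted_mem_iff by blast
  then obtain f where f: "\<And>j. j \<in> partners (extracted M') i \<Longrightarrow> {Copy i (f j), BarHalf i j} \<in> M'"
    by metis
  have range: "f j \<in> {1..b i}" if "j \<in> partners (extracted M') i" for j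
    using Copy_BarHalf_mem_red_edgesD(2)[OF subsetD[OF srp_matching(2) f[OF that]]] .
  have "inj_on f (partners (extracted M') i)"
  proof (rule inj_onI)
    fix j k assume jk: "j \<in> partners (extracted M') i" "k \<in> partners (extracted M') i" "f j = f k"
    have "{Copy i (f j), BarHalf i j} = {Copy i (f k), BarHalf i k}"
      using red_matching_unique[OF srp_matching(1) f[OF jk(1)] f[OF jk(2)], of "Copy i (f j)"]
        red_vertices_memI(1)[OF i range[OF jk(1)]] jk(3) by simp
    then show "j = k" by (simp add: doubleton_eq_iff)
  qed
  then show thesis using that f range by blast
qed

lemma b_matching_extracted: "b_matching V E b (extracted M')"
  unfolding b_matching_def
proof (intro conjI ballI)
  show "extracted M' \<subseteq> E" by (rule extracted_subset)
  fix i assume "i \<in> V"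
  then obtain f where "inj_on f (partners (extracted M') i)"
    "\<And>j. j \<in> partners (extracted M') i \<Longrightarrow> f j \<in> {1..b i} \<and> {Copy i (f j), BarHalf i j} \<in> M'"
    using copy_assignment by metis
  then have "card (partners (extracted M') i) \<le> card {1..b i}"
    by (intro card_inj_on_le[of f]) auto
  then show "card {e \<in> extracted M'. i \<in> e} \<le> b i"
    using card_incident[OF extracted_subset] by simp
qed

lemma half_le_utility:
  assumes half: "\<And>k. {i, k} \<in> extracted M' \<Longrightarrow> p i k = p' (Half i k)"
    and ij: "{i, j} \<in> E" "{i, j} \<notin> extracted M'"
  shows "ereal (p' (Half i j)) \<le> utility b (extracted M') p i"
proof -
  note i = edge_vertices(1)[OF ij(1)]
  obtain f where inj: "inj_on f (partners (extracted M') i)"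
    and f: "\<And>k. k \<in> partners (extracted M') i \<Longrightarrow> f k \<in> {1..b i} \<and> {Copy i (f k), BarHalf i k} \<in> M'"
    using copy_assignment[OF i] by metis
  \<comment> \<open>By \<open>gadget_half\<close> the payoffs of \<open>BarHalf i j\<close> and
    \<open>Half i j\<close> add up to the weight, so stability at a copy compares
    \<open>p' (Half i j)\<close> with the copy directly.\<close>
  have le_copy: "p' (Half i j) \<le> p' (Copy i s)" if "s \<in> {1..b i}" for s
    using srp_stable_le[OF stable red_edges_memI(1)[OF ij(1), of s b]] that gadget_half(1)[OF ij]
    by simp
  show ?thesis
  proof (cases "saturated b (extracted M') i")
    case True
    have "p' (Half i j) \<le> p i k" if k: "k \<in> partners (extracted M') i" for k
    proof -
      have ik: "{i, k} \<in> extracted M'" using k unfolding partners_def by simp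
      then have E: "{i, k} \<in> E" using extracted_subset by blast
      have "w {i, k} \<le> p' (BarHalf i k) + p' (Half i k)"
        using srp_stable_le[OF stable red_edges_memI(2)[OF E]] by simp
      moreover have "p' (Copy i (f k)) + p' (BarHalf i k) = w {i, k}"
        using srp_payoff(3)[of "Copy i (f k)"] f[OF k] by simp
      ultimately have "p' (Copy i (f k)) \<le> p i k" using half[OF ik] by simp
      then show ?thesis using le_copy f[OF k] by force
    qed
    \<comment> \<open>At capacity 0 the infimum over no partners is infinite and the bound is
      trivial.\<close>
    then show ?thesis using True unfolding utility_def by (auto intro!: INF_greatest)
  next
    case False
    then have "card (partners (extracted M') i) < b i"
      using card_incident[OF extracted_subset] card_partners_le[OF b_matching_extracted i]
      unfolding saturated_def by simp
    then have "card (f ` partners (extracted M') i) < card {1..b i}"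
      using card_image[OF inj] by simp
    then have "f ` partners (extracted M') i \<noteq> {1..b i}" by auto
    then obtain s where s: "s \<in> {1..b i}" "s \<notin> f ` partners (extracted M') i"
      using f by blast
    have V': "Copy i s \<in> V'" using red_vertices_memI(1)[OF i s(1)] .
    have "p' (Copy i s) = 0"
    proof (cases "Copy i s \<in> \<Union>M'")
      case True
      then obtain e where e: "e \<in> M'" "Copy i s \<in> e" by blast
      then obtain k where k: "{i, k} \<in> E" "e = {Copy i s, BarHalf i k}"
        using red_edge_at_Copy subsetD[OF srp_matching(2)] by metis
      \<comment> \<open>The spare copy may be matched into a gadget, but not into that of an
        extracted edge, whose barred vertex is already matched to copy \<open>f k\<close>.\<close>
      have "{i, k} \<notin> extracted M'"
      proof
        assume "{i, k} \<in> extracted M'"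
        then have k': "k \<in> partners (extracted M') i" unfolding partners_def by simp
        have "{Copy i (f k), BarHalf i k} = e"
          using red_matching_unique[OF srp_matching(1) _ e(1), of _ "BarHalf i k"]
            f[OF k'] k(2) red_vertices_memI(3)[OF k(1)] by simp
        then have "s = f k" using k(2) by (simp add: doubleton_eq_iff)
        then show False using s(2) k' by blast
      qed
      then show ?thesis using gadget_half(2)[OF k(1)] e(1) k(2) by simp
    qed (rule srp_payoff(2)[OF V'])
    then show ?thesis using le_copy[OF s(1)] False unfolding utility_def by simp
  qed
qed

text \<open>The payoff is a parameter, so that this serves both a payoff given in advance and the
  one built from \<open>p'\<close>. The bounds of \<open>half_le_utility\<close> at both ends are
  added along the middle edge.\<close>

lemma sfp_stable_extracted:
  assumes half: "\<And>i j. {i, j} \<in> extracted M' \<Longrightarrow> p i j = p' (Half i j)"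
    and compat: "compatible_payoff V w (extracted M') p"
  shows "sfp_stable_solution V E b w (extracted M') p"
  unfolding sfp_stable_solution_def sfp_solution_def
proof (intro conjI allI impI)
  fix i j assume ij: "{i, j} \<in> E - extracted M'"
  then have ji: "{j, i} \<in> E - extracted M'" by (simp add: insert_commute)
  have "w {i, j} \<le> p' (Half i j) + p' (Half j i)"
    using srp_stable_le[OF stable red_edges_memI(3)] ij by simp
  then have "ereal (w {i, j}) \<le> ereal (p' (Half i j)) + ereal (p' (Half j i))" by simp
  also have "\<dots> \<le> utility b (extracted M') p i + utility b (extracted M') p j"
    using half_le_utility[of i p j] half_le_utility[of j p i] half ij ji by (intro add_mono) auto
  finally show "ereal (w {i, j}) \<le> utility b (extracted M') p i + utility b (extracted M') p j" .
qed (fact b_matching_extracted compat)+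

lemma compatible_payoff_extracted:
  "compatible_payoff V w (extracted M') (\<lambda>i j. if {i, j} \<in> extracted M' then p' (Half i j) else 0)"
proof -
  have "0 \<le> p' (Half i j)" if "{i, j} \<in> extracted M'" for i j
    using that extracted_subset red_vertices_memI(2) srp_payoff(1) by blast
  moreover have "p' (Half i j) + p' (Half j i) = w {i, j}" if "{i, j} \<in> extracted M'" for i j
    using that srp_payoff(3)[of "Half i j" "Half j i"] unfolding extracted_mem_iff by simp
  ultimately show ?thesis unfolding compatible_payoff_def by (simp add: insert_commute)
qed

end

section \<open>The three equivalences\<close>

lemma sfp_stable_if_reduced:
  assumes "b_matching V E b M" "srp_stable_solution V' E' w' M' p'" "reduced_matching V E M M'"
    and "\<And>i j. {i, j} \<in> M \<Longrightarrow> p' (Half i j) = p i j" "compatible_payoff V w M p"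
  shows "max_weight_b_matching V E b w M" "sfp_stable_solution V E b w M p"
proof -
  show stable: "sfp_stable_solution V E b w M p"
    using sfp_stable_extracted[OF assms(2), of p] extracted_reduced[OF assms(1,3)] assms(4,5) by simp
  then show "max_weight_b_matching V E b w M"
    using max_weight_if_stable unfolding sfp_stable_solution_def by blast
qed

lemma reduced_if_sfp_stable:
  assumes "sfp_stable_solution V E b w M p"
  shows "\<exists>M' p'. srp_stable_solution V' E' w' M' p' \<and> reduced_matching V E M M' \<and>
    (\<forall>i j. {i, j} \<in> M \<longrightarrow> p' (Half i j) = p i j)"
proof -
  have sol: "sfp_solution V E b w M p" using assms unfolding sfp_stable_solution_def by blast
  obtain M' p' where red: "reduced_solution V E b w M p M' p'"
    using reduced_solution_exists[OF sol] by blast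
  show ?thesis
    using srp_stable_reduced[OF sol red assms] reduced_matching[OF sol red]
      reduced_payoff_matched(1)[OF sol red] by blast
qed

end

theorem theorem3:
  fixes V :: "'v set" and E :: "'v set set" and b :: "'v \<Rightarrow> nat" and w :: "'v set \<Rightarrow> real"
    and V' :: "'v rvertex set" and E' :: "'v rvertex set set" and w' :: "'v rvertex set \<Rightarrow> real"
  assumes "sfp_instance V E b w"
    and "V' = red_vertices V E b" and "E' = red_edges E b" and "w' = red_weight w"
  shows
    "((\<exists>M p. sfp_stable_solution V E b w M p) \<longleftrightarrow>
        (\<exists>M' p'. srp_stable_solution V' E' w' M' p'))
     \<and>
     (((\<exists>M p. max_weight_b_matching V E b w M \<and> sfp_stable_solution V E b w M p) \<longleftrightarrow>
        (\<exists>M p M' p'. b_matching V E b M \<and> srp_stable_solution V' E' w' M' p' \<and>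
           reduced_matching V E M M' \<and> (\<forall>i j. {i, j} \<in> M \<longrightarrow> p' (Half i j) = p i j)))
      \<and>
      (\<forall>M p. sfp_solution V E b w M p \<longrightarrow>
        (max_weight_b_matching V E b w M \<and> sfp_stable_solution V E b w M p \<longleftrightarrow>
          (\<exists>M' p'. srp_stable_solution V' E' w' M' p' \<and>
             reduced_matching V E M M' \<and> (\<forall>i j. {i, j} \<in> M \<longrightarrow> p' (Half i j) = p i j)))))
     \<and>
     (\<forall>M p. max_weight_b_matching V E b w M \<and> sfp_solution V E b w M p \<longrightarrow>
        (sfp_stable_solution V E b w M p \<longleftrightarrow>
          (\<forall>M' p'. srp_solution V' E' w' M' p' \<and> reduced_solution V E b w M p M' p' \<longrightarrow>
             srp_stable_solution V' E' w' M' p')))"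
proof -
  interpret sfp V E b w by standard (rule assms(1))
  note defs = assms(2-4)
  have iff: "max_weight_b_matching V E b w M \<and> sfp_stable_solution V E b w M p \<longleftrightarrow>
      (\<exists>M' p'. srp_stable_solution V' E' w' M' p' \<and>
         reduced_matching V E M M' \<and> (\<forall>i j. {i, j} \<in> M \<longrightarrow> p' (Half i j) = p i j))"
    if sol: "sfp_solution V E b w M p" for M p
  proof
    assume "max_weight_b_matching V E b w M \<and> sfp_stable_solution V E b w M p"
    then show "\<exists>M' p'. srp_stable_solution V' E' w' M' p' \<and>
         reduced_matching V E M M' \<and> (\<forall>i j. {i, j} \<in> M \<longrightarrow> p' (Half i j) = p i j)"
      using reduced_if_sfp_stable unfolding defs by blast
  next
    assume "\<exists>M' p'. srp_stable_solution V' E' w' M' p' \<and>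
         reduced_matching V E M M' \<and> (\<forall>i j. {i, j} \<in> M \<longrightarrow> p' (Half i j) = p i j)"
    then show "max_weight_b_matching V E b w M \<and> sfp_stable_solution V E b w M p"
      using sol sfp_stable_if_reduced unfolding defs sfp_solution_def by metis
  qed
  have from_reduced: "\<exists>p. sfp_stable_solution V E b w (extracted M') p \<and>
      (\<forall>i j. {i, j} \<in> extracted M' \<longrightarrow> p' (Half i j) = p i j)"
    if "srp_stable_solution V' E' w' M' p'" for M' p'
  proof -
    let ?p = "\<lambda>i j. if {i, j} \<in> extracted M' then p' (Half i j) else 0"
    note stable = that[unfolded defs]
    have "sfp_stable_solution V E b w (extracted M') ?p"
      by (rule sfp_stable_extracted[OF stable _ compatible_payoff_extracted[OF stable]]) simp
    then show ?thesis by (intro exI[of _ ?p]) simp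
  qed
  have i: "(\<exists>M p. sfp_stable_solution V E b w M p) \<longleftrightarrow> (\<exists>M' p'. srp_stable_solution V' E' w' M' p')"
    using reduced_if_sfp_stable from_reduced unfolding defs by blast
  have ii: "(\<exists>M p. max_weight_b_matching V E b w M \<and> sfp_stable_solution V E b w M p) \<longleftrightarrow>
        (\<exists>M p M' p'. b_matching V E b M \<and> srp_stable_solution V' E' w' M' p' \<and>
           reduced_matching V E M M' \<and> (\<forall>i j. {i, j} \<in> M \<longrightarrow> p' (Half i j) = p i j))"
    (is "?L \<longleftrightarrow> ?R")
  proof
    assume ?L
    then obtain M p where "max_weight_b_matching V E b w M" "sfp_stable_solution V E b w M p" by blast
    then show ?R
      using iff[of M p] unfolding sfp_stable_solution_def max_weight_b_matching_def by blast
  next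
    assume ?R
    then obtain M M' p' where M: "b_matching V E b M" "srp_stable_solution V' E' w' M' p'"
      "reduced_matching V E M M'" by blast
    \<comment> \<open>The \<open>p\<close> on the right need not vanish off \<open>M\<close>, so a
      compatible payoff is taken from \<open>p'\<close> instead; its b-matching
      \<open>extracted M'\<close> equals \<open>M\<close>.\<close>
    then obtain p where "sfp_stable_solution V E b w M p"
      using from_reduced[OF M(2)] extracted_reduced by metis
    then show ?L using max_weight_if_stable unfolding sfp_stable_solution_def by blast
  qed
  have iii: "sfp_stable_solution V E b w M p \<longleftrightarrow>
      (\<forall>M' p'. srp_solution V' E' w' M' p' \<and> reduced_solution V E b w M p M' p' \<longrightarrow>
         srp_stable_solution V' E' w' M' p')"
    if sol: "sfp_solution V E b w M p" for M p
  proof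
    assume "sfp_stable_solution V E b w M p"
    then show "\<forall>M' p'. srp_solution V' E' w' M' p' \<and> reduced_solution V E b w M p M' p' \<longrightarrow>
         srp_stable_solution V' E' w' M' p'"
      using srp_stable_reduced[OF sol] unfolding defs by blast
  next
    assume all: "\<forall>M' p'. srp_solution V' E' w' M' p' \<and> reduced_solution V E b w M p M' p' \<longrightarrow>
         srp_stable_solution V' E' w' M' p'"
    \<comment> \<open>Existence of a reduced pair keeps the universal statement from being vacuous;
      a single instance suffices.\<close>
    obtain M' p' where red: "reduced_solution V E b w M p M' p'"
      using reduced_solution_exists[OF sol] by blast
    then have "srp_stable_solution V' E' w' M' p'"
      using all srp_solution_reduced[OF sol red] unfolding defs by blast
    then show "sfp_stable_solution V E b w M p"
      using iff[OF sol] reduced_matching[OF sol red] reduced_payoff_matched(1)[OF sol red] by blast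
  qed
  show ?thesis using i ii iff iii by blast
qed

end
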